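(* Let $k\ge 2$, $m\ge 1$ and $r\ge 0$ be integers. Then the polynomial $$q_{m,k}(t)=\sum_{i=0}^{k}(-1)^i e_{i,k,m}(x,s)\,t^{k-i}$$ is the characteristic polynomial of the subsequence $\left(F^{(k)}_{mn+r}(x,s)\right)_{n\ge 0}$ of the generalized Fibonacci polynomials, i.e. $$\sum_{i=0}^{k}(-1)^i e_{i,k,m}(x,s)\,F^{(k)}_{m(n+k-i)+r}(x,s)=0\qquad\text{for all integers } n\ge 0.$$
   Context: The generalized Fibonacci polynomials $F_n^{(k)}(x,s)$ are defined by $F_0^{(k)}(x,s)=0$, $F_n^{(k)}(x,s)=x^{n-1}$ for $0<n<k$, and $F_n^{(k)}(x,s)=xF_{n-1}^{(k)}(x,s)+sF_{n-k}^{(k)}(x,s)$ for $n\ge k$. Let $\alpha_1(x,s),\dots,\alpha_k(x,s)$ be the roots (in an algebraic closure of $\mathbb{Q}(x,s)$, counted with multiplicity) of the polynomial $w^k-xw^{k-1}-s$ in the variable $w$. Define $e_{i,k,m}(x,s)\in\mathbb{Z}[x,s]$ for $0\le i\le k$ by $$\prod_{j=1}^{k}\left(w-\alpha_j(x,s)^m\right)=\sum_{i=0}^{k}(-1)^i e_{i,k,m}(x,s)\,w^{k-i},$$ i.e. $e_{i,k,m}(x,s)$ is the $i$-th elementary symmetric polynomial of $\alpha_1^m,\dots,\alpha_k^m$. Convention: a polynomial $p(t)=\sum_i c_it^i$ is called the characteristic polynomial of a sequence $(f(n))_{n\ge 0}$ if $\sum_i c_if(n+i)=0$ for all $n\ge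 0$ (no minimality of the degree is required). *)

theory Defs
  imports
    "HOL-Algebra.Algebraic_Closure_Type"
    "HOL-Computational_Algebra.Computational_Algebra"
    "Jordan_Normal_Form.Char_Poly"
begin

text \<open>\<open>\<int>[x,s]\<close> is \<open>int poly poly\<close>, with \<open>s\<close> the outer and \<open>x\<close> the inner variable.\<close>

definition var_x :: "int poly poly" where
  "var_x = [:[:0, 1:]:]"

definition var_s :: "int poly poly" where
  "var_s = [:0, 1:]"

text \<open>The case \<open>k = 0\<close> is excluded only to make the recursion terminate.\<close>

fun gen_fib :: "nat \<Rightarrow> nat \<Rightarrow> int poly poly" where
  "gen_fib k n =
     (if n = 0 \<or> k = 0 then 0
      else if n < k then var_x ^ (n - 1)
      else var_x * gen_fib k (n - 1) + var_s * gen_fib k (n - k))"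

declare gen_fib.simps [simp del]

text \<open>\<open>\<rat>(x,s)\<close> is the fraction field of \<open>\<int>[x,s]\<close>.\<close>

type_synonym closure_Qxs = "int poly poly fract alg_closure"

definition emb :: "int poly poly \<Rightarrow> closure_Qxs" where
  "emb p = to_ac (to_fract p)"

definition root_poly :: "nat \<Rightarrow> closure_Qxs poly" where
  "root_poly k = Polynomial.monom 1 k - Polynomial.monom (emb var_x) (k - 1) - [:emb var_s:]"

text \<open>The product \<open>\<Prod>\<^sub>j (w - \<alpha>\<^sub>j ^ m)\<close>.\<close>

definition power_root_poly :: "nat \<Rightarrow> nat \<Rightarrow> closure_Qxs poly" where
  "power_root_poly k m = (\<Prod>\<alpha>\<in>#proots (root_poly k). [:- (\<alpha> ^ m), 1:])"

text \<open>
  The elements \<open>e\<^sub>i\<^sub>,\<^sub>k\<^sub>,\<^sub>m\<close> of \<open>\<int>[x,s]\<close>. The lemma \<open>power_root_poly_eq\<close> below shows that for \<open>k \<ge> 2\<close>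
  and \<open>i \<le> k\<close> the described element exists (it is unique as \<open>emb\<close> is injective).
\<close>

definition esym :: "nat \<Rightarrow> nat \<Rightarrow> nat \<Rightarrow> int poly poly" where
  "esym i k m = (THE c. emb c = (-1) ^ i * Polynomial.coeff (power_root_poly k m) (k - i))"

definition q_poly :: "nat \<Rightarrow> nat \<Rightarrow> int poly poly poly" where
  "q_poly m k = (\<Sum>i=0..k. Polynomial.monom ((-1) ^ i * esym i k m) (k - i))"

definition is_characteristic_poly :: "'a::comm_ring_1 poly \<Rightarrow> (nat \<Rightarrow> 'a) \<Rightarrow> bool" where
  "is_characteristic_poly p f \<longleftrightarrow>
     (\<forall>n. (\<Sum>i\<le>Polynomial.degree p. Polynomial.coeff p i * f (n + i)) = 0)"

lemma emb_0 [simp]: "emb 0 = 0" and emb_1 [simp]: "emb 1 = 1"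
  and emb_add: "emb (p + q) = emb p + emb q"
  and emb_mult: "emb (p * q) = emb p * emb q"
  and emb_uminus: "emb (- p) = - emb p"
  and emb_diff: "emb (p - q) = emb p - emb q"
  and emb_eq_iff [simp]: "emb p = emb q \<longleftrightarrow> p = q"
  by (simp_all add: emb_def)

interpretation emb: inj_comm_ring_hom emb
  by unfold_locales (use emb_eq_iff[of _ 0] in \<open>simp_all add: emb_add emb_mult\<close>)

lemma var_s_power_ne:
  assumes "n \<noteq> 0"
  shows "of_int n * var_s \<noteq> of_int c * var_x ^ j"
proof
  assume eq: "of_int n * var_s = of_int c * var_x ^ j"
  have "var_x ^ j = [:[:0, 1:] ^ j:]"
    by (simp add: var_x_def poly_const_pow)
  hence "Polynomial.coeff (of_int c * var_x ^ j) 1 = 0"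
    by (simp add: of_int_poly)
  moreover have "Polynomial.coeff (of_int n * var_s) 1 = of_int n"
    by (simp add: var_s_def of_int_poly)
  ultimately show False using eq assms by simp
qed

lemma poly_root_poly:
  "poly (root_poly k) a = a ^ k - emb var_x * a ^ (k - 1) - emb var_s"
  by (simp add: root_poly_def poly_monom)

lemma degree_root_poly:
  assumes "k \<ge> 2"
  shows "Polynomial.degree (root_poly k) = k" "Polynomial.coeff (root_poly k) k = 1"
proof -
  show 1: "Polynomial.coeff (root_poly k) k = 1"
    using assms by (auto simp: root_poly_def coeff_pCons split: nat.splits)
  have "Polynomial.coeff (root_poly k) n = 0" if "n > k" for n
    using assms that by (auto simp: root_poly_def coeff_pCons split: nat.splits)
  hence "Polynomial.degree (root_poly k) \<le> k" by (intro degree_le) auto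
  moreover have "k \<le> Polynomial.degree (root_poly k)" using 1 by (intro le_degree) auto
  ultimately show "Polynomial.degree (root_poly k) = k" by simp
qed

lemma rsquarefree_root_poly:
  assumes "k \<ge> 2"
  shows "rsquarefree (root_poly k)"
  unfolding rsquarefree_roots
proof (intro allI notI, elim conjE)
  fix a
  assume r: "poly (root_poly k) a = 0" "poly (pderiv (root_poly k)) a = 0"
  obtain j where k: "k = Suc (Suc j)" using assms by (metis Suc_le_D numeral_2_eq_2 Suc_le_mono)
  define x where "x = emb var_x"
  define y where "y = emb var_s"
  define N where "N = (of_nat (Suc (Suc j)) :: closure_Qxs)"
  define M where "M = (of_nat (Suc j) :: closure_Qxs)"
  have 1: "y = a ^ Suc (Suc j) - x * a ^ Suc j"
    using r(1) unfolding poly_root_poly k x_def y_def by (simp add: algebra_simps)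
  have "y \<noteq> 0"
    using var_s_power_ne[of 1 0 0] by (simp add: y_def emb.hom_0_iff)
  hence a: "a \<noteq> 0" using 1 by (intro notI) simp
  have "N * a ^ Suc j - M * x * a ^ j = 0"
    using r(2) by (simp add: root_poly_def k N_def M_def x_def pderiv_diff pderiv_monom poly_monom pderiv_pCons)
  hence "a ^ j * (N * a - M * x) = 0" by (simp add: algebra_simps)
  hence Na: "N * a = M * x" using a by simp
  have "N ^ Suc (Suc j) * y = (N * a) ^ Suc (Suc j) - N * x * (N * a) ^ Suc j"
    unfolding 1 by (simp add: power_mult_distrib algebra_simps)
  also have "\<dots> = (M ^ Suc (Suc j) - N * M ^ Suc j) * x ^ Suc (Suc j)"
    unfolding Na by (simp add: power_mult_distrib algebra_simps)
  finally have "emb (of_int (int (Suc (Suc j)) ^ Suc (Suc j)) * var_s) =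
      emb (of_int (int (Suc j) ^ Suc (Suc j) - int (Suc (Suc j)) * int (Suc j) ^ Suc j) * var_x ^ Suc (Suc j))"
    unfolding N_def M_def x_def y_def
    by (simp only: emb_mult emb_diff emb.hom_of_nat emb.hom_power of_int_power of_int_diff of_int_mult of_int_of_nat_eq)
  hence "of_int (int (Suc (Suc j)) ^ Suc (Suc j)) * var_s =
      of_int (int (Suc j) ^ Suc (Suc j) - int (Suc (Suc j)) * int (Suc j) ^ Suc j) * var_x ^ Suc (Suc j)"
    unfolding emb_eq_iff .
  moreover have "int (Suc (Suc j)) ^ Suc (Suc j) \<noteq> 0" by (subst power_eq_0_iff) auto
  ultimately show False using var_s_power_ne by blast
qed

lemma root_poly_roots:
  assumes "k \<ge> 2"
  obtains as where "length as = k" "distinct as" "proots (root_poly k) = mset as"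
    "\<And>a. a \<in> set as \<Longrightarrow> a ^ k = emb var_x * a ^ (k - 1) + emb var_s"
proof -
  let ?p = "root_poly k"
  have p0: "?p \<noteq> 0" using degree_root_poly[OF assms] by auto
  obtain A where A: "size A = Polynomial.degree ?p"
    "?p = Polynomial.smult (Polynomial.lead_coeff ?p) (\<Prod>x\<in>#A. [:-x, 1:])"
    using alg_closed_imp_factorization[OF p0] by blast
  have "proots (\<Prod>x\<in>#B. [:-x, 1:]) = B" for B :: "closure_Qxs multiset"
  proof (induction B)
    case (add x B)
    have "(\<Prod>x\<in>#B. [:-x, 1:]) \<noteq> 0" by (auto simp: prod_mset_zero_iff)
    then show ?case using add by (simp add: proots_mult del: mult_pCons_left)
  qed simp
  hence pA: "proots ?p = A" using A(2) p0 by (metis proots_smult smult_0_left)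
  obtain as where as: "mset as = A" using ex_mset by blast
  have "count (mset as) a = (if a \<in> set as then 1 else 0)" for a
  proof -
    have "count (mset as) a = 0 \<or> count (mset as) a = 1"
      using rsquarefree_root_poly[OF assms] p0 unfolding as pA[symmetric] rsquarefree_def by simp
    moreover have "count (mset as) a = 0 \<longleftrightarrow> a \<notin> set as"
      by (rule count_mset_0_iff)
    ultimately show ?thesis by presburger
  qed
  hence "distinct as" by (simp add: distinct_count_atmost_1)
  moreover have "length as = k" using as A(1) degree_root_poly[OF assms] by (metis size_mset)
  moreover have "a ^ k = emb var_x * a ^ (k - 1) + emb var_s" if "a \<in> set as" for a
  proof -
    have "a \<in># proots ?p" using that as pA by (metis set_mset_mset)
    hence "poly ?p a = 0" using p0 by simp
    thus ?thesis by (simp add: poly_root_poly algebra_simps)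
  qed
  ultimately show ?thesis using that as pA by metis
qed

text \<open>A matrix over \<open>\<int>[x,s]\<close> with eigenvalues \<open>\<alpha>\<^sub>j\<close>, diagonalised by the Vandermonde matrix.\<close>

definition companion :: "nat \<Rightarrow> int poly poly mat" where
  "companion k = Matrix.mat k k (\<lambda>(i, j).
     if Suc j < k then (if i = Suc j then 1 else 0)
     else (if i = 0 then var_s else if i = k - 1 then var_x else 0))"

lemma vandermonde_mult_companion:
  assumes k: "k \<ge> 2" and len: "length as = k"
    and root: "\<And>a. a \<in> set as \<Longrightarrow> a ^ k = emb var_x * a ^ (k - 1) + emb var_s"
  defines "V \<equiv> Matrix.mat k k (\<lambda>(i, j). (as ! i) ^ j)"
  shows "V * map_mat emb (companion k) = mat_diag k (\<lambda>i. as ! i) * V"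
proof -
  have V: "V \<in> carrier_mat k k" by (simp add: V_def)
  show ?thesis
    unfolding mat_diag_mult_left[OF V]
  proof (rule eq_matI)
    fix i j
    assume "i < dim_row (Matrix.mat k k (\<lambda>(i, j). as ! i * V $$ (i, j)))"
      and "j < dim_col (Matrix.mat k k (\<lambda>(i, j). as ! i * V $$ (i, j)))"
    hence i: "i < k" and j: "j < k" by auto
    let ?a = "as ! i"
    have "(V * map_mat emb (companion k)) $$ (i, j) =
        (\<Sum>l\<in>{0..<k}. ?a ^ l * emb (companion k $$ (l, j)))"
      using i j by (simp add: V_def scalar_prod_def companion_def)
    also have "\<dots> = ?a * ?a ^ j"
    proof (cases "Suc j < k")
      case True
      have "(\<Sum>l\<in>{0..<k}. ?a ^ l * emb (companion k $$ (l, j))) =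
          (\<Sum>l\<in>{0..<k}. if l = Suc j then ?a ^ l else 0)"
        using True j by (intro sum.cong) (auto simp: companion_def)
      thus ?thesis using True by simp
    next
      case False
      hence jk: "j = k - 1" using j by auto
      have "(\<Sum>l\<in>{0..<k}. ?a ^ l * emb (companion k $$ (l, j))) =
          (\<Sum>l\<in>{0..<k}. (if l = 0 then emb var_s else 0) + (if l = k - 1 then ?a ^ l * emb var_x else 0))"
        using False j k by (intro sum.cong) (auto simp: companion_def)
      also have "\<dots> = emb var_s + ?a ^ (k - 1) * emb var_x"
        using k by (simp add: sum.distrib)
      also have "\<dots> = ?a ^ k"
        using root[of ?a] i len by (simp add: algebra_simps)
      also have "\<dots> = ?a * ?a ^ j"
        using k jk by (metis Suc_diff_1 power_Suc not_numeral_le_zero not_gr0)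
      finally show ?thesis .
    qed
    finally show "(V * map_mat emb (companion k)) $$ (i, j) =
        Matrix.mat k k (\<lambda>(i, j). as ! i * V $$ (i, j)) $$ (i, j)"
      using i j by (simp add: V_def)
  qed (simp_all add: V_def companion_def)
qed

lemma det_vandermonde_nonzero:
  fixes as :: "'a::field list"
  assumes len: "length as = k" and dist: "distinct as" and k: "k > 0"
  shows "det (Matrix.mat k k (\<lambda>(i, j). (as ! i) ^ j)) \<noteq> 0" (is "det ?V \<noteq> 0")
proof
  assume "det ?V = 0"
  then obtain v where v: "v \<in> carrier_vec k" "v \<noteq> 0\<^sub>v k" "?V *\<^sub>v v = 0\<^sub>v k"
    using det_0_iff_vec_prod_zero_field[of ?V k] by auto
  define p where "p = (\<Sum>j<k. Polynomial.monom (v $ j) j)"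
  have cp: "Polynomial.coeff p j = (if j < k then v $ j else 0)" for j
    by (simp add: p_def coeff_sum)
  have "poly p a = 0" if "a \<in> set as" for a
  proof -
    obtain i where i: "i < k" "a = as ! i" using \<open>a \<in> set as\<close> len by (metis in_set_conv_nth)
    have "(?V *\<^sub>v v) $ i = (\<Sum>j\<in>{0..<k}. a ^ j * v $ j)"
      using i v(1) by (simp add: scalar_prod_def)
    hence "(\<Sum>j\<in>{0..<k}. a ^ j * v $ j) = 0" using v(3) i by simp
    thus ?thesis
      by (simp add: p_def poly_sum poly_monom atLeast0LessThan mult.commute)
  qed
  hence sub: "set as \<subseteq> {a. poly p a = 0}" by auto
  have "Polynomial.degree p < k"
    using k by (intro degree_lessI) (auto simp: cp)
  moreover have "p \<noteq> 0"
  proof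
    assume "p = 0"
    hence "v $ j = 0" if "j < k" for j using cp[of j] that by simp
    hence "v = 0\<^sub>v k" using v(1) by (intro eq_vecI) auto
    thus False using v(2) by simp
  qed
  ultimately show False
    using card_mono[OF poly_roots_finite sub] card_poly_roots_bound[of p] distinct_card[OF dist] len
    by (simp add: card_mono)
qed

lemma power_root_poly_in_range:
  assumes k: "k \<ge> 2"
  obtains p :: "int poly poly poly" where "power_root_poly k m = map_poly emb p"
    "Polynomial.degree p = k"
proof -
  obtain as where as: "length as = k" "distinct as" "proots (root_poly k) = mset as"
    and root: "\<And>a. a \<in> set as \<Longrightarrow> a ^ k = emb var_x * a ^ (k - 1) + emb var_s"
    using root_poly_roots[OF k] by blast
  define V where "V = Matrix.mat k k (\<lambda>(i, j). (as ! i) ^ j)"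
  define D where "D = mat_diag k (\<lambda>i. as ! i)"
  let ?C = "map_mat emb (companion k)"
  have V: "V \<in> carrier_mat k k" and D: "D \<in> carrier_mat k k" and C0: "companion k \<in> carrier_mat k k"
    by (simp_all add: V_def D_def companion_def)
  hence C: "?C \<in> carrier_mat k k" by simp
  have "det V \<noteq> 0" unfolding V_def using k as by (intro det_vandermonde_nonzero) auto
  from det_non_zero_imp_unit[OF V this, of "()"]
  obtain W where W: "W \<in> carrier_mat k k" "W * V = 1\<^sub>m k" "V * W = 1\<^sub>m k"
    by (auto simp: Units_def ring_mat_def)
  have VC: "V * ?C = D * V"
    unfolding V_def D_def using vandermonde_mult_companion[OF k as(1) root] .
  have "?C = W * V * ?C" using W C by simp
  also have "\<dots> = W * (D * V)" using W(1) V C VC by simp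
  also have "\<dots> = W * D * V" using W(1) V D by simp
  finally have "similar_mat_wit ?C D W V"
    using W V D C by (intro similar_mat_witI[of _ _ k]) auto
  from similar_mat_wit_pow[OF this, of m] have sim: "similar_mat (?C ^\<^sub>m m) (D ^\<^sub>m m)"
    by (auto simp: similar_mat_def)
  have Dm: "D ^\<^sub>m m = mat_diag k (\<lambda>i. (as ! i) ^ m)"
    unfolding D_def
  proof (induction m)
    case 0
    show ?case by (simp add: mat_diag_def)
  qed (simp add: mult.commute)
  have ut: "upper_triangular (mat_diag k (\<lambda>i. (as ! i) ^ m))"
    by (auto simp: mat_diag_def)
  have "char_poly (?C ^\<^sub>m m) = (\<Prod>a\<leftarrow>diag_mat (mat_diag k (\<lambda>i. (as ! i) ^ m)). [:- a, 1:])"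
    unfolding char_poly_similar[OF sim] Dm
    by (rule char_poly_upper_triangular[OF mat_diag_dim ut])
  also have "diag_mat (mat_diag k (\<lambda>i. (as ! i) ^ m)) = map (\<lambda>a. a ^ m) as"
    using as(1) by (intro nth_equalityI) (auto simp: diag_mat_def mat_diag_def)
  also have "(\<Prod>a\<leftarrow>map (\<lambda>a. a ^ m) as. [:- a, 1:]) = power_root_poly k m"
    by (simp add: power_root_poly_def as(3) prod_mset_prod_list[symmetric] o_def flip: mset_map)
  finally have eq: "char_poly (?C ^\<^sub>m m) = power_root_poly k m" .
  have "?C ^\<^sub>m m = map_mat emb (companion k ^\<^sub>m m)"
    using emb.mat_hom_pow[OF C0] by simp
  hence "power_root_poly k m = map_poly emb (char_poly (companion k ^\<^sub>m m))"
    using eq emb.char_poly_hom[of "companion k ^\<^sub>m m" k] C0 by simp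
  moreover have "Polynomial.degree (char_poly (companion k ^\<^sub>m m)) = k"
    using degree_monic_char_poly[of "companion k ^\<^sub>m m" k] C0 by simp
  ultimately show ?thesis using that by blast
qed

lemma emb_esym:
  assumes "k \<ge> 2"
  shows "emb (esym i k m) = (-1) ^ i * Polynomial.coeff (power_root_poly k m) (k - i)"
proof -
  obtain p where p: "power_root_poly k m = map_poly emb p"
    using power_root_poly_in_range[OF assms] by blast
  have ex: "emb ((-1) ^ i * Polynomial.coeff p (k - i)) =
      (-1) ^ i * Polynomial.coeff (power_root_poly k m) (k - i)"
    by (simp add: p emb_mult emb.hom_power emb_uminus coeff_map_poly)
  show ?thesis
    unfolding esym_def ex[symmetric] emb_eq_iff by simp
qed

lemma power_root_poly_eq:
  assumes "k \<ge> 2"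
  shows "power_root_poly k m =
    (\<Sum>i=0..k. Polynomial.monom ((-1) ^ i * emb (esym i k m)) (k - i))"
proof -
  have deg: "Polynomial.degree (power_root_poly k m) \<le> k"
    using power_root_poly_in_range[OF assms] by (metis degree_map_poly_le)
  have "(\<Sum>i=0..k. Polynomial.monom ((-1) ^ i * emb (esym i k m)) (k - i)) =
      (\<Sum>i=0..k. Polynomial.monom (Polynomial.coeff (power_root_poly k m) (k - i)) (k - i))"
    by (intro sum.cong refl) (simp add: emb_esym[OF assms] mult.assoc[symmetric] flip: power_mult_distrib)
  also have "\<dots> = (\<Sum>i\<le>k. Polynomial.monom (Polynomial.coeff (power_root_poly k m) i) i)"
    by (rule sum.reindex_bij_witness[of _ "\<lambda>i. k - i" "\<lambda>i. k - i"]) auto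
  also have "\<dots> = power_root_poly k m"
    using poly_as_sum_of_monoms'[OF deg] .
  finally show ?thesis by simp
qed

end

(* Write shift_comb p f n for the p-combination of the values f n, f (n+1), ....  The polynomials
   p with shift_comb p f = 0 form an ideal.  For f the Fibonacci sequence it contains
   w^k - x w^(k-1) - s = \<Prod>(w - \<alpha>), which divides \<Prod>(w^m - \<alpha>^m), the power-root polynomial evaluated at
   w^m; and shift_comb of p(w^m) picks out exactly the values of f along a progression of step m. *)

theory Submission
  imports Defs
begin

definition shift_comb :: "'a::comm_ring_1 poly \<Rightarrow> (nat \<Rightarrow> 'a) \<Rightarrow> nat \<Rightarrow> 'a" where
  "shift_comb p f n = (\<Sum>i\<le>Polynomial.degree p. Polynomial.coeff p i * f (n + i))"

lemma is_characteristic_poly_iff_shift_comb: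
  "is_characteristic_poly p f \<longleftrightarrow> (\<forall>n. shift_comb p f n = 0)"
  by (simp add: is_characteristic_poly_def shift_comb_def)

lemma shift_comb_eq_sum:
  assumes "Polynomial.degree p \<le> N"
  shows "shift_comb p f n = (\<Sum>i\<le>N. Polynomial.coeff p i * f (n + i))"
  unfolding shift_comb_def
  using assms by (intro sum.mono_neutral_left) (auto simp: coeff_eq_0)

lemma shift_comb_0 [simp]: "shift_comb 0 f n = 0"
  by (simp add: shift_comb_def)

text \<open>Multiplying by w moves the starting index by one; this Horner step drives the inductions
  on polynomials below.\<close>

lemma shift_comb_pCons [simp]:
  "shift_comb (pCons a p) f n = a * f n + shift_comb p f (Suc n)"
proof -
  \<comment> \<open>For \<open>p = 0\<close> the degree of \<open>pCons a p\<close> is 0, not 1, so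
    the sum is taken up to a bound valid in both cases.\<close>
  have "shift_comb (pCons a p) f n =
      (\<Sum>i\<le>Suc (Polynomial.degree p). Polynomial.coeff (pCons a p) i * f (n + i))"
    by (intro shift_comb_eq_sum degree_pCons_le)
  also have "\<dots> = a * f n + shift_comb p f (Suc n)"
    by (subst sum.atMost_Suc_shift) (simp add: shift_comb_def)
  finally show ?thesis .
qed

lemma shift_comb_add: "shift_comb (p + q) f n = shift_comb p f n + shift_comb q f n"
proof -
  let ?N = "max (Polynomial.degree p) (Polynomial.degree q)"
  show ?thesis
    by (simp add: shift_comb_eq_sum[of _ ?N] degree_add_le_max distrib_right sum.distrib)
qed

lemma shift_comb_smult: "shift_comb (Polynomial.smult c p) f n = c * shift_comb p f n"
  by (induction p arbitrary: n) (simp_all add: algebra_simps)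

lemma shift_comb_diff: "shift_comb (p - q) f n = shift_comb p f n - shift_comb q f n"
  using shift_comb_add[of "p - q" q f n] by simp

lemma shift_comb_monom: "shift_comb (Polynomial.monom c m) f n = c * f (n + m)"
  by (induction m arbitrary: n) (simp_all add: monom_0 monom_Suc)

lemma shift_comb_monom_mult:
  "shift_comb (Polynomial.monom 1 m * p) f n = shift_comb p f (n + m)"
proof (induction m arbitrary: n)
  case (Suc m)
  then show ?case by (simp add: monom_Suc)
qed (simp add: monom_0)

lemma shift_comb_pcompose_monom:
  "shift_comb (p \<circ>\<^sub>p Polynomial.monom 1 m) f (m * n + r) = shift_comb p (\<lambda>n. f (m * n + r)) n"
proof (induction p arbitrary: n)
  case (pCons a p)
  \<comment> \<open>The factor w^m that composition puts in front of the tail of p advances the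
    progression by one term.\<close>
  have "m * n + r + m = m * Suc n + r" by simp
  hence "shift_comb (p \<circ>\<^sub>p Polynomial.monom 1 m) f (m * n + r + m) =
      shift_comb p (\<lambda>n. f (m * n + r)) (Suc n)"
    by (simp only: pCons.IH)
  then show ?case
    by (simp add: pcompose_pCons shift_comb_add shift_comb_monom_mult)
qed simp

lemma is_characteristic_poly_dvd:
  assumes "is_characteristic_poly p f" and "p dvd q"
  shows "is_characteristic_poly q f"
proof -
  \<comment> \<open>A new coefficient of h adds a scalar multiple of p and multiplies the rest by w,
    so the claim is needed at every n.\<close>
  have "shift_comb (h * p) f n = 0" for h n
    using assms(1)
    by (induction h arbitrary: n)
      (simp_all add: is_characteristic_poly_iff_shift_comb shift_comb_add shift_comb_smult)
  moreover obtain h where "q = h * p"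
    using assms(2) by (metis dvd_def mult.commute)
  ultimately show ?thesis
    by (simp add: is_characteristic_poly_iff_shift_comb)
qed

lemma is_characteristic_poly_subsequence:
  assumes "is_characteristic_poly p f" and "p dvd q \<circ>\<^sub>p Polynomial.monom 1 m"
  shows "is_characteristic_poly q (\<lambda>n. f (m * n + r))"
  using is_characteristic_poly_dvd[OF assms]
  by (simp add: is_characteristic_poly_iff_shift_comb flip: shift_comb_pcompose_monom)

text \<open>The roots live only in the closure, while the claim concerns \<int>[x,s]. Since
  \<open>emb\<close> is an injective ring homomorphism, it preserves degrees and reflects
  zero.\<close>

lemma is_characteristic_poly_map_emb_iff:
  "is_characteristic_poly (map_poly emb p) (\<lambda>n. emb (f n)) \<longleftrightarrow> is_characteristic_poly p f"
proof -
  have "shift_comb (map_poly emb p) (\<lambda>n. emb (f n)) n = emb (shift_comb p f n)" for n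
    by (simp add: shift_comb_def emb_mult emb.hom_sum coeff_map_poly)
  thus ?thesis
    by (simp add: is_characteristic_poly_iff_shift_comb emb.hom_0_iff)
qed

lemma root_poly_characteristic:
  assumes "k \<ge> 1"
  shows "is_characteristic_poly (root_poly k) (\<lambda>n. emb (gen_fib k n))"
proof -
  \<comment> \<open>The index n + k is never below k, so the recursive branch applies.\<close>
  have "gen_fib k (n + k) = var_x * gen_fib k (n + (k - 1)) + var_s * gen_fib k n" for n
    using assms by (subst gen_fib.simps) simp
  thus ?thesis
    by (simp add: is_characteristic_poly_iff_shift_comb root_poly_def shift_comb_diff
        shift_comb_monom emb_add emb_mult)
qed

lemma root_poly_eq_prod:
  assumes "k \<ge> 2"
  shows "root_poly k = (\<Prod>a\<in>#proots (root_poly k). [:-a, 1:])"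
proof -
  have lead: "Polynomial.lead_coeff (root_poly k) = 1"
    using degree_root_poly[OF assms] by simp
  hence "root_poly k \<noteq> 0" by auto
  then obtain A where A: "root_poly k = (\<Prod>a\<in>#A. [:-a, 1:])"
    using alg_closed_imp_factorization[of "root_poly k"] lead by auto
  \<comment> \<open>This identifies the multiset A from the factorization with the roots,
    multiplicities included.\<close>
  have "proots (\<Prod>a\<in>#B. [:-a, 1:]) = B" for B :: "closure_Qxs multiset"
  proof (induction B)
    case (add a B)
    have "(\<Prod>a\<in>#B. [:-a, 1:]) \<noteq> 0" by (auto simp: prod_mset_zero_iff)
    then show ?case using add by (simp add: proots_mult del: mult_pCons_left)
  qed simp
  thus ?thesis using A by simp
qed

lemma root_poly_dvd_power_root_poly:
  assumes "k \<ge> 2"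
  shows "root_poly k dvd power_root_poly k m \<circ>\<^sub>p Polynomial.monom 1 m"
proof -
  \<comment> \<open>The right side is w^m - a^m, which vanishes at w = a; divisibility then
    multiplies up factor by factor.\<close>
  have "[:-a, 1:] dvd [:- (a ^ m), 1:] \<circ>\<^sub>p Polynomial.monom 1 m" for a :: closure_Qxs
    by (simp add: dvd_iff_poly_eq_0 poly_pcompose poly_monom del: pcompose_pCons)
  hence "(\<Prod>a\<in>#A. [:-a, 1:]) dvd (\<Prod>a\<in>#A. [:- (a ^ m), 1:]) \<circ>\<^sub>p Polynomial.monom 1 m"
    for A :: "closure_Qxs multiset"
    by (induction A)
      (simp_all add: pcompose_mult mult_dvd_mono del: mult_pCons_left pcompose_pCons)
  thus ?thesis
    unfolding power_root_poly_def by (subst root_poly_eq_prod[OF assms])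
qed

lemma map_emb_q_poly:
  assumes "k \<ge> 2"
  shows "map_poly emb (q_poly m k) = power_root_poly k m"
proof -
  have "map_poly emb (q_poly m k) =
      (\<Sum>i=0..k. Polynomial.monom ((-1) ^ i * emb (esym i k m)) (k - i))"
    unfolding q_poly_def
    by (intro poly_eqI)
      (simp add: coeff_map_poly coeff_sum emb.hom_sum emb_mult emb.hom_power emb_uminus if_distrib
        cong: if_cong)
  thus ?thesis using power_root_poly_eq[OF assms] by simp
qed

theorem mainTheorem5:
  fixes k m r :: nat
  assumes "k \<ge> 2" and "m \<ge> 1"
  shows "is_characteristic_poly (q_poly m k) (\<lambda>n. gen_fib k (m * n + r)) \<and>
         (\<forall>n. (\<Sum>i=0..k. (-1) ^ i * esym i k m * gen_fib k (m * (n + k - i) + r)) = 0)"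
proof -
  let ?f = "\<lambda>n. gen_fib k (m * n + r)"
  have "is_characteristic_poly (power_root_poly k m) (\<lambda>n. emb (?f n))"
    using assms(1) by (intro is_characteristic_poly_subsequence[OF root_poly_characteristic]
        root_poly_dvd_power_root_poly) auto
  hence char: "is_characteristic_poly (q_poly m k) ?f"
    by (simp add: is_characteristic_poly_map_emb_iff flip: map_emb_q_poly[OF assms(1)])
  \<comment> \<open>Linearity expands \<open>q_poly\<close> monomial by monomial, giving the
    explicit sum without computing its degree.\<close>
  have "shift_comb (\<Sum>i\<in>I. Polynomial.monom (c i) (k - i)) ?f n = (\<Sum>i\<in>I. c i * ?f (n + (k - i)))"
    if "finite I" for I :: "nat set" and c n
    using that by induction (simp_all add: shift_comb_add shift_comb_monom)
  hence "shift_comb (q_poly m k) ?f n =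
      (\<Sum>i=0..k. (-1) ^ i * esym i k m * gen_fib k (m * (n + k - i) + r))" for n
    by (simp add: q_poly_def)
  with char show ?thesis
    by (simp add: is_characteristic_poly_iff_shift_comb)
qed

end
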